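(* For every $\beta\ge0$ and every $h>h_c(\beta)$, $\partial_h^2\textsc{f}(\beta,h)>0$.
   Context: Let $\tau=(\tau_j)_{j\ge0}$ be a renewal process with $\tau_0=0$ and i.i.d. increments with values in $\mathbb N$, law $\mathbf P$, expectation $\mathbf E$; $K(n)=\mathbf P(\tau_1=n)>0$ for all $n$, $K(n)\sim C_Kn^{-(1+\alpha)}$, $\alpha>0$, $C_K>0$. $\delta_n=\mathbf 1_{n\in\{\tau_0,\tau_1,\dots\}}$. Let $\omega=(\omega_n)_{n\ge1}$ be i.i.d. with law $\mathbb P$, independent of $\tau$, $\lambda(s)=\log\mathbb E e^{s\omega_1}<\infty$ for all $s$, $\mathbb E\omega_1=0$, $\mathbb E\omega_1^2=1$. The disordered pinning free energy is $\textsc{f}(\beta,h)=\lim_{N\to\infty}\frac1N\log\mathbf E[\exp(\sum_{j=1}^N(\beta\omega_j+h)\delta_j)\delta_N]$ ($\mathbb P$-a.s. limit, deterministic), and $h_c(\beta):=\inf\{h:\textsc{f}(\beta,h)>0\}$; $\textsc{f}(\beta,\cdot)$ is smooth on $(h_c(\beta),\infty)$. *)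

theory Defs
  imports "HOL-Probability.Probability" "HOL-Library.Landau_Symbols"
begin

text \<open>Renewal law: K n = P(tau_1 = n). For a finite set A of positive integers,
  the probability that the renewal set restricted to {1..N} equals A (with
  tau_0 = 0) is the product of K over the consecutive gaps.\<close>

definition prev_pt :: "nat set \<Rightarrow> nat \<Rightarrow> nat" where
  "prev_pt A j = Max (insert 0 {i \<in> A. i < j})"

definition renewal_prob :: "(nat \<Rightarrow> real) \<Rightarrow> nat set \<Rightarrow> real" where
  "renewal_prob K A = (\<Prod>j\<in>A. K (j - prev_pt A j))"

text \<open>Constrained partition function
  Z_N = E[exp(sum_{j=1}^N (beta omega_j + h) delta_j) delta_N],
  the expectation over the renewal written out as a sum over the possible
  renewal sets A in {1..N} containing N.\<close>

definition pin_Z :: "(nat \<Rightarrow> real) \<Rightarrow> real \<Rightarrow> real \<Rightarrow> (nat \<Rightarrow> real) \<Rightarrow> nat \<Rightarrow> real" where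
  "pin_Z K \<beta> h \<omega> N =
     (\<Sum>A \<in> {A. A \<subseteq> {1..N} \<and> N \<in> A}.
        renewal_prob K A * exp (\<Sum>j\<in>A. \<beta> * \<omega> j + h))"

definition free_energy :: "(nat \<Rightarrow> real) \<Rightarrow> real measure \<Rightarrow> real \<Rightarrow> real \<Rightarrow> real" where
  "free_energy K \<mu> \<beta> h =
     (THE f. AE \<omega> in PiM UNIV (\<lambda>_. \<mu>).
        (\<lambda>N. ln (pin_Z K \<beta> h \<omega> N) / real N) \<longlonglongrightarrow> f)"

definition crit_h :: "(nat \<Rightarrow> real) \<Rightarrow> real measure \<Rightarrow> real \<Rightarrow> real" where
  "crit_h K \<mu> \<beta> = Inf {h. free_energy K \<mu> \<beta> h > 0}"

end

theory Submission
  imports Defs "HOL-Real_Asymp.Real_Asymp"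
begin

text \<open>
  It suffices to bound the symmetric second difference of the free energy at \<open>h\<close> from below
  by a multiple of \<open>t\<^sup>2\<close>, hence the variance of the number of contacts under the finite volume
  Gibbs measure by a multiple of \<open>N\<close>, locally uniformly in the pinning parameter.

  If the sites \<open>k - 1\<close> and \<open>k + 1\<close> are contacts, then resampling site \<open>k\<close> only involves \<open>\<omega> k\<close>.
  Testing the contact number against the sum of these local fluctuations bounds its
  variance below by the expected number of triples of consecutive contacts at sites with moderate
  disorder. Since \<open>K (n + 1) / K n\<close> is bounded, inserting two contacts in front of a given one
  costs a bounded factor, so such triples are at least a fixed fraction of all contacts, up to the
  number of sites with large disorder. Finally, the contact density is the derivative of a
  convex function and is bounded below by a chord slope, which is positive because the free energy
  is positive at some \<open>h' < h\<close> and is at most of order \<open>exp y\<close> as \<open>y\<close> tends to minus infinity.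

  No law of large numbers is needed: by Markov's inequality the relevant empirical averages are
  bounded by twice their mean with probability at least one half, hence for infinitely many \<open>N\<close>
  on an event that meets every event of full measure.
\<close>

section \<open>Analytic and probabilistic preliminaries\<close>

lemma exists_AE_frequently_avg_le:
  fixes \<mu> :: "'a measure" and g :: "'a \<Rightarrow> real" and P :: "(nat \<Rightarrow> 'a) \<Rightarrow> bool"
  assumes "prob_space \<mu>" and g: "integrable \<mu> g" "\<And>x. g x \<ge> 0"
    and c: "c > 0" "2 * (\<integral>x. g x \<partial>\<mu>) \<le> c"
    and P: "AE \<omega> in PiM UNIV (\<lambda>_. \<mu>). P \<omega>"
  shows "\<exists>\<omega>. P \<omega> \<and> (\<exists>\<^sub>F N in sequentially. (\<Sum>j=1..N. g (\<omega> j)) \<le> c * real N)"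
proof -
  let ?M = "PiM UNIV (\<lambda>_::nat. \<mu>)"
  interpret M: prob_space ?M by (intro prob_space_PiM assms)
  have distr: "distr ?M \<mu> (\<lambda>\<omega>. \<omega> j) = \<mu>" for j
    by (rule distr_PiM_component) (use assms in auto)
  have [measurable]: "g \<in> borel_measurable \<mu>" using g by auto
  have int: "integrable ?M (\<lambda>\<omega>. g (\<omega> j))" for j
    using integrable_distr[of "\<lambda>\<omega>. \<omega> j" ?M \<mu> g] distr[of j] g(1) by simp
  have exp: "(\<integral>\<omega>. g (\<omega> j) \<partial>?M) = (\<integral>x. g x \<partial>\<mu>)" for j
    using integral_distr[of "\<lambda>\<omega>. \<omega> j" ?M \<mu> g] distr[of j] by simp
  define E where "E N = {\<omega>\<in>space ?M. (\<Sum>j=1..N. g (\<omega> j)) \<le> c * real N}" for N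
  have E_sets [measurable]: "E N \<in> sets ?M" for N
    unfolding E_def by measurable
  have half: "M.prob (E N) \<ge> 1/2" if "N \<ge> 1" for N
  proof -
    let ?B = "{\<omega>\<in>space ?M. (\<Sum>j=1..N. g (\<omega> j)) \<ge> c * real N}"
    have "M.prob ?B \<le> (\<integral>\<omega>. (\<Sum>j=1..N. g (\<omega> j)) \<partial>?M) / (c * real N)"
      by (rule integral_Markov_inequality_measure[where A = "{}"])
        (use int g c that in \<open>auto intro!: sum_nonneg\<close>)
    also have "(\<integral>\<omega>. (\<Sum>j=1..N. g (\<omega> j)) \<partial>?M) = real N * (\<integral>x. g x \<partial>\<mu>)"
      using int by (simp add: exp)
    also have "\<dots> / (c * real N) \<le> 1/2"
      using c that by (simp add: field_simps)
    finally have "M.prob ?B \<le> 1/2" .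
    moreover have "M.prob (space ?M - ?B) \<le> M.prob (E N)"
      by (rule M.finite_measure_mono) (auto simp: E_def)
    moreover have "M.prob (space ?M - ?B) = 1 - M.prob ?B"
      by (rule M.prob_compl) measurable
    ultimately show ?thesis by linarith
  qed
  define D where "D n = (\<Union>m\<in>{Suc n..}. E m)" for n
  have D_sets: "D n \<in> sets ?M" for n unfolding D_def by measurable
  have "decseq D"
    unfolding decseq_def D_def by (intro allI impI UN_mono) auto
  then have "(\<lambda>n. M.prob (D n)) \<longlonglongrightarrow> M.prob (\<Inter>n. D n)"
    using D_sets by (intro M.finite_Lim_measure_decseq) auto
  moreover have "M.prob (D n) \<ge> 1/2" for n
  proof -
    have "M.prob (E (Suc n)) \<le> M.prob (D n)"
      by (rule M.finite_measure_mono) (use D_sets in \<open>auto simp: D_def\<close>)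
    with half[of "Suc n"] show ?thesis by simp
  qed
  ultimately have pos: "M.prob (\<Inter>n. D n) \<ge> 1/2"
    by (intro LIMSEQ_le_const) auto
  have "\<exists>\<omega>\<in>\<Inter>n. D n. P \<omega>"
  proof (rule ccontr)
    assume "\<not> ?thesis"
    then have "AE \<omega> in ?M. \<omega> \<notin> (\<Inter>n. D n)" using P by (auto elim!: eventually_mono)
    then have "M.prob (\<Inter>n. D n) = 0"
      using D_sets by (subst M.prob_eq_0) auto
    with pos show False by simp
  qed
  then obtain \<omega> where \<omega>: "\<omega> \<in> (\<Inter>n. D n)" "P \<omega>" by blast
  have "\<exists>N\<ge>n. (\<Sum>j=1..N. g (\<omega> j)) \<le> c * real N" for n
  proof -
    have "\<omega> \<in> D n" using \<omega> by blast
    then obtain m where "m \<ge> Suc n" "\<omega> \<in> E m" by (auto simp: D_def)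
    then show ?thesis by (intro exI[of _ m]) (auto simp: E_def)
  qed
  with \<omega>(2) show ?thesis by (auto simp: frequently_sequentially)
qed

lemma second_deriv_ge_of_symmetric_difference:
  fixes f :: "real \<Rightarrow> real"
  assumes f: "\<And>y. y > a \<Longrightarrow> f differentiable at y" and h: "h > a"
    and f': "deriv f differentiable at h"
    and d: "d > 0" and le: "\<And>t. 0 < t \<Longrightarrow> t < d \<Longrightarrow> c * t\<^sup>2 \<le> f (h + t) + f (h - t) - 2 * f h"
  shows "c \<le> deriv (deriv f) h"
proof (rule ccontr)
  assume less: "\<not> ?thesis"
  define D where "D = deriv (deriv f) h"
  define \<epsilon> where "\<epsilon> = (c - D) / 2"
  have \<epsilon>: "\<epsilon> > 0" using less by (simp add: \<epsilon>_def D_def)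
  have "(deriv f has_real_derivative D) (at h)"
    using f' by (simp add: D_def DERIV_deriv_iff_real_differentiable)
  then have "((\<lambda>t. (deriv f (h + t) - deriv f h) / t) \<longlongrightarrow> D) (at 0)"
    by (simp add: DERIV_def)
  then have "\<forall>\<^sub>F t in at 0. dist ((deriv f (h + t) - deriv f h) / t) D < \<epsilon>"
    using \<epsilon> by (rule tendstoD)
  then obtain r where r: "r > 0"
    "\<And>t. t \<noteq> 0 \<Longrightarrow> \<bar>t\<bar> < r \<Longrightarrow> \<bar>(deriv f (h + t) - deriv f h) / t - D\<bar> < \<epsilon>"
    by (auto simp: eventually_at dist_real_def)
  define t where "t = Min {d, r, h - a} / 2"
  have t: "t > 0" "t < d" "t < r" "t < h - a"
    using d r(1) h by (auto simp: t_def min_def)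
  define G where "G x = f (h + x) + f (h - x) - c * x\<^sup>2" for x
  have G': "(G has_real_derivative deriv f (h + x) - deriv f (h - x) - 2 * c * x) (at x)"
    if "0 \<le> x" "x \<le> t" for x
  proof -
    have "(f has_real_derivative deriv f (h + x)) (at (h + x))"
         "(f has_real_derivative deriv f (h - x)) (at (h - x))"
      using f[of "h + x"] f[of "h - x"] that t
      by (auto simp: DERIV_deriv_iff_real_differentiable)
    from DERIV_chain2[where f = f and g = "\<lambda>x. h + x" and x = x, OF this(1)]
      DERIV_chain2[where f = f and g = "\<lambda>x. h - x" and x = x, OF this(2)]
    have "((\<lambda>x. f (h + x)) has_real_derivative deriv f (h + x)) (at x)"
         "((\<lambda>x. f (h - x)) has_real_derivative - deriv f (h - x)) (at x)"
      by (force intro!: derivative_eq_intros)+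
    then show ?thesis unfolding G_def by (auto intro!: derivative_eq_intros)
  qed
  have "\<exists>z. 0 < z \<and> z < t \<and>
      G t - G 0 = (t - 0) * (deriv f (h + z) - deriv f (h - z) - 2 * c * z)"
    by (rule MVT2) (use t G' in auto)
  then obtain z where z: "0 < z" "z < t"
    "G t - G 0 = t * (deriv f (h + z) - deriv f (h - z) - 2 * c * z)" by auto
  have "(deriv f (h + z) - deriv f h) / z < D + \<epsilon>" "(deriv f h - deriv f (h - z)) / z < D + \<epsilon>"
    using r(2)[of z] r(2)[of "-z"] z t by (auto simp: abs_less_iff minus_divide_left)
  then have "deriv f (h + z) - deriv f (h - z) < 2 * (D + \<epsilon>) * z"
    using z(1) by (simp add: field_simps)
  also have "\<dots> = 2 * (D + \<epsilon> - c) * z + 2 * c * z" by (simp add: algebra_simps)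
  also have "\<dots> < 2 * c * z"
  proof -
    have eq: "D + \<epsilon> - c = - \<epsilon>" by (simp add: \<epsilon>_def field_simps)
    show ?thesis unfolding eq using z(1) \<epsilon> by simp
  qed
  finally have "G t - G 0 < 0" using z(3) t(1) by (simp add: mult_pos_neg)
  with le[OF t(1,2)] show False by (simp add: G_def)
qed

text \<open>The left-hand side is the squared partition sum times the variance of \<open>X\<close>
  under the Gibbs weights \<open>W\<close>; \<open>Y\<close> is a centred test function.\<close>

lemma gibbs_variance_ge:
  fixes W X Y :: "'a \<Rightarrow> real"
  assumes W: "\<And>x. x \<in> S \<Longrightarrow> W x > 0" and S: "finite S" "S \<noteq> {}"
    and Y: "(\<Sum>x\<in>S. W x * Y x) = 0"
  shows "(\<Sum>x\<in>S. W x * (X x)\<^sup>2) * (\<Sum>x\<in>S. W x) - (\<Sum>x\<in>S. W x * X x)\<^sup>2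
    \<ge> (\<Sum>x\<in>S. W x) * (2 * a * (\<Sum>x\<in>S. W x * (X x * Y x)) - a\<^sup>2 * (\<Sum>x\<in>S. W x * (Y x)\<^sup>2))"
proof -
  define Z where "Z = (\<Sum>x\<in>S. W x)"
  have Z: "Z > 0" unfolding Z_def using W S by (intro sum_pos) auto
  define T where "T = (\<Sum>x\<in>S. W x * X x)"
  define m where "m = T / Z"
  have "0 \<le> (\<Sum>x\<in>S. W x * (X x - m - a * Y x)\<^sup>2)"
    using W by (intro sum_nonneg) (simp add: less_imp_le)
  also have "\<dots> = (\<Sum>x\<in>S. W x * (X x)\<^sup>2 - 2 * m * (W x * X x) + m\<^sup>2 * W x
      - 2 * a * (W x * (X x * Y x)) + 2 * a * m * (W x * Y x) + a\<^sup>2 * (W x * (Y x)\<^sup>2))"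
    by (intro sum.cong) (auto simp: power2_eq_square algebra_simps)
  also have "\<dots> = (\<Sum>x\<in>S. W x * (X x)\<^sup>2) - 2 * m * T + m\<^sup>2 * Z
      - 2 * a * (\<Sum>x\<in>S. W x * (X x * Y x)) + a\<^sup>2 * (\<Sum>x\<in>S. W x * (Y x)\<^sup>2)"
    by (simp add: sum.distrib sum_subtractf flip: sum_distrib_left) (simp add: Y T_def Z_def)
  finally have "0 \<le> \<dots> * Z" using Z by simp
  also have "\<dots> = (\<Sum>x\<in>S. W x * (X x)\<^sup>2) * Z - 2 * (m * Z) * T + (m * Z)\<^sup>2
      - Z * (2 * a * (\<Sum>x\<in>S. W x * (X x * Y x)) - a\<^sup>2 * (\<Sum>x\<in>S. W x * (Y x)\<^sup>2))"
    by (simp add: power2_eq_square algebra_simps)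
  also have "m * Z = T" using Z by (simp add: m_def)
  finally show ?thesis by (simp add: Z_def T_def power2_eq_square)
qed

lemma DERIV_ln_partition_sum:
  fixes w c :: "'a \<Rightarrow> real"
  assumes "\<And>x. x \<in> S \<Longrightarrow> w x > 0" "finite S" "S \<noteq> {}"
  shows "((\<lambda>s. ln (\<Sum>x\<in>S. w x * exp (s * c x))) has_real_derivative
    (\<Sum>x\<in>S. w x * exp (s * c x) * c x) / (\<Sum>x\<in>S. w x * exp (s * c x))) (at s)"
proof -
  have "(\<Sum>x\<in>S. w x * exp (s * c x)) > 0" using assms by (intro sum_pos) auto
  then show ?thesis
    by (auto intro!: derivative_eq_intros simp: mult_ac)
qed

lemma DERIV_gibbs_mean:
  fixes w c :: "'a \<Rightarrow> real"
  assumes "\<And>x. x \<in> S \<Longrightarrow> w x > 0" "finite S" "S \<noteq> {}"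
  shows "((\<lambda>s. (\<Sum>x\<in>S. w x * exp (s * c x) * c x) / (\<Sum>x\<in>S. w x * exp (s * c x)))
    has_real_derivative
    ((\<Sum>x\<in>S. w x * exp (s * c x) * (c x)\<^sup>2) * (\<Sum>x\<in>S. w x * exp (s * c x))
      - (\<Sum>x\<in>S. w x * exp (s * c x) * c x)\<^sup>2) / (\<Sum>x\<in>S. w x * exp (s * c x))\<^sup>2) (at s)"
proof -
  have "(\<Sum>x\<in>S. w x * exp (s * c x)) > 0" using assms by (intro sum_pos) auto
  then show ?thesis
    by (auto intro!: derivative_eq_intros simp: mult_ac power2_eq_square)
qed

lemma symmetric_difference_ge:
  fixes f f' f'' :: "real \<Rightarrow> real"
  assumes "\<And>x. x \<in> {h-t..h+t} \<Longrightarrow> (f has_real_derivative f' x) (at x)"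
    and "\<And>x. x \<in> {h-t..h+t} \<Longrightarrow> (f' has_real_derivative f'' x) (at x)"
    and ge: "\<And>x. x \<in> {h-t..h+t} \<Longrightarrow> f'' x \<ge> m" and t: "t \<ge> 0"
  shows "f (h + t) + f (h - t) - 2 * f h \<ge> m * t\<^sup>2"
proof -
  have "convex_on {h-t..h+t} (\<lambda>x. f x - m / 2 * x\<^sup>2)"
  proof (rule f''_ge0_imp_convex)
    show "((\<lambda>x. f x - m / 2 * x\<^sup>2) has_real_derivative f' x - m * x) (at x)"
      if "x \<in> {h-t..h+t}" for x
      using assms(1)[OF that] by (auto intro!: derivative_eq_intros)
    show "((\<lambda>x. f' x - m * x) has_real_derivative f'' x - m) (at x)"
      if "x \<in> {h-t..h+t}" for x
      using assms(2)[OF that] by (auto intro!: derivative_eq_intros)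
  qed (use ge in auto)
  from convex_onD[OF this, of "1/2" "h-t" "h+t"] t
  have "f h - m / 2 * h\<^sup>2 \<le> (f (h-t) - m/2 * (h-t)\<^sup>2) / 2 + (f (h+t) - m/2 * (h+t)\<^sup>2) / 2"
    by (simp add: field_simps)
  then show ?thesis by (simp add: power2_eq_square field_simps)
qed

lemma bounded_ratio_of_power_asymp:
  fixes K :: "nat \<Rightarrow> real"
  assumes Kpos: "\<And>n. n \<ge> 1 \<Longrightarrow> K n > 0" and C: "C > 0"
    and K: "K \<sim>[at_top] (\<lambda>n. C * real n powr (-(1 + \<alpha>)))"
  shows "\<exists>B>0. \<forall>n\<ge>1. K (Suc n) \<le> B * K n"
proof -
  let ?g = "\<lambda>n. C * real n powr (-(1 + \<alpha>))"
  have "filterlim Suc at_top at_top" by (rule filterlim_Suc)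
  then have "(\<lambda>n. K (Suc n)) \<sim>[at_top] (\<lambda>n. ?g (Suc n))"
    using K asymp_equiv_compose'[of K sequentially ?g Suc sequentially] by simp
  also have "(\<lambda>n. ?g (Suc n)) \<sim>[at_top] ?g"
    using C by real_asymp
  also have "?g \<sim>[at_top] K" using K by (simp add: asymp_equiv_sym)
  finally have "(\<lambda>n. K (Suc n)) \<sim>[at_top] K" .
  then have "((\<lambda>n. K (Suc n) / K n) \<longlongrightarrow> 1) sequentially"
    by (rule asymp_equivD_strong)
      (use Kpos in \<open>force simp: eventually_at_top_linorder intro!: exI[of _ 1]\<close>)
  then have "Bseq (\<lambda>n. K (Suc n) / K n)" by (intro convergent_imp_Bseq convergentI)
  then obtain B where B: "B > 0" "\<And>n. \<bar>K (Suc n) / K n\<bar> \<le> B" by (auto elim: BseqE)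
  have "K (Suc n) \<le> B * K n" if "n \<ge> 1" for n
    using B(2)[of n] Kpos[OF that] Kpos[of "Suc n"] by (simp add: field_simps)
  with B(1) show ?thesis by blast
qed

section \<open>Local modifications of contact sets\<close>

definition pin_conf :: "nat \<Rightarrow> nat set set" where
  "pin_conf N = {A. A \<subseteq> {1..N} \<and> N \<in> A}"

definition pin_weight :: "(nat \<Rightarrow> real) \<Rightarrow> real \<Rightarrow> real \<Rightarrow> (nat \<Rightarrow> real) \<Rightarrow> nat set \<Rightarrow> real" where
  "pin_weight K \<beta> s \<omega> A = renewal_prob K A * exp (\<Sum>j\<in>A. \<beta> * \<omega> j + s)"

lemma pin_Z_eq: "pin_Z K \<beta> s \<omega> N = (\<Sum>A\<in>pin_conf N. pin_weight K \<beta> s \<omega> A)"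
  by (simp add: pin_Z_def pin_conf_def pin_weight_def)

lemma finite_pin_conf [simp]: "finite (pin_conf N)"
  unfolding pin_conf_def by (rule finite_subset[of _ "Pow {1..N}"]) auto

lemma pin_conf_nonempty: "N \<ge> 1 \<Longrightarrow> pin_conf N \<noteq> {}"
  unfolding pin_conf_def by (auto intro!: exI[of _ "{N}"])

lemma pin_confD:
  assumes "A \<in> pin_conf N"
  shows "finite A" "A \<subseteq> {1..N}" "N \<in> A"
  using assms by (auto simp: pin_conf_def intro: finite_subset)

lemma prev_pt_less: "finite A \<Longrightarrow> j \<ge> 1 \<Longrightarrow> prev_pt A j < j"
  unfolding prev_pt_def by (subst Max_less_iff) auto

lemma prev_pt_eqI:
  assumes "finite A" "i = 0 \<or> i \<in> A" "i < j" "\<And>x. x \<in> A \<Longrightarrow> x < j \<Longrightarrow> x \<le> i"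
  shows "prev_pt A j = i"
  unfolding prev_pt_def using assms by (intro Max_eqI) auto

lemma renewal_prob_pos:
  assumes "finite A" "A \<subseteq> {1..}" "\<And>n. n \<ge> 1 \<Longrightarrow> K n > 0"
  shows "renewal_prob K A > 0"
  unfolding renewal_prob_def
proof (rule prod_pos)
  fix j assume "j \<in> A"
  then have "prev_pt A j < j" using assms by (intro prev_pt_less) auto
  then show "K (j - prev_pt A j) > 0" using assms(3) by simp
qed

lemma pin_weight_pos:
  assumes "A \<in> pin_conf N" "\<And>n. n \<ge> 1 \<Longrightarrow> K n > 0"
  shows "pin_weight K \<beta> s \<omega> A > 0"
  unfolding pin_weight_def using renewal_prob_pos[of A K] pin_confD[OF assms(1)] assms(2) by force

lemma pin_weight_shift: "pin_weight K \<beta> s \<omega> A = pin_weight K \<beta> 0 \<omega> A * exp (s * real (card A))"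
  by (simp add: pin_weight_def sum.distrib exp_add mult_ac)

lemma renewal_prob_insert:
  assumes A: "finite A" "i \<ge> 1" "i \<notin> A" "Suc i \<in> A"
  shows "renewal_prob K (insert i A) * K (Suc i - prev_pt A i)
    = renewal_prob K A * (K (i - prev_pt A i) * K 1)"
proof -
  define B where "B = A - {Suc i}"
  have AB: "A = insert (Suc i) B" "finite B" "Suc i \<notin> B" "i \<notin> B"
    using A by (auto simp: B_def)
  have prev_i: "prev_pt (insert i A) i = prev_pt A i"
    unfolding prev_pt_def by (rule arg_cong[where f = Max]) auto
  have prev_Suc: "prev_pt A (Suc i) = prev_pt A i"
    unfolding prev_pt_def
    by (rule arg_cong[where f = Max]) (use A(3) in \<open>auto simp: less_Suc_eq\<close>)
  have prev_ins: "prev_pt (insert i A) (Suc i) = i"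
    by (rule prev_pt_eqI) (use A in auto)
  have prev_other: "prev_pt (insert i A) j = prev_pt A j" if "j \<in> B" for j
  proof (cases "j \<le> i")
    case True
    then show ?thesis
      unfolding prev_pt_def by (intro arg_cong[where f = Max]) auto
  next
    case False
    then have j: "Suc i < j" using that AB(3) by (metis not_less_eq_eq nat_less_le)
    define m where "m = prev_pt A j"
    have fin: "finite (insert 0 {x \<in> A. x < j})" using A by simp
    then have m: "m \<in> insert 0 {x \<in> A. x < j}" unfolding m_def prev_pt_def by (intro Max_in) auto
    have le: "x \<le> m" if "x \<in> A" "x < j" for x
      unfolding m_def prev_pt_def using fin that by (intro Max_ge) auto
    have "Suc i \<le> m" using le j A(4) by blast
    then have "prev_pt (insert i A) j = m"
      by (intro prev_pt_eqI) (use A m le in auto)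
    then show ?thesis by (simp add: m_def)
  qed
  define R where "R = (\<Prod>j\<in>B. K (j - prev_pt A j))"
  have "renewal_prob K (insert i A) = K (i - prev_pt A i) * K 1 * R"
  proof -
    have "renewal_prob K (insert i A) = K (i - prev_pt (insert i A) i) *
        (K (Suc i - prev_pt (insert i A) (Suc i)) * (\<Prod>j\<in>B. K (j - prev_pt (insert i A) j)))"
      unfolding renewal_prob_def AB(1) using AB(2-4) by (subst prod.insert) auto
    also have "(\<Prod>j\<in>B. K (j - prev_pt (insert i A) j)) = R"
      unfolding R_def by (intro prod.cong) (auto simp: prev_other)
    finally show ?thesis by (simp add: prev_i prev_ins)
  qed
  moreover have "renewal_prob K A = K (Suc i - prev_pt A i) * R"
  proof -
    have "renewal_prob K A = K (Suc i - prev_pt A (Suc i)) * R"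
      unfolding renewal_prob_def R_def using AB(2,3) by (subst AB(1), subst prod.insert) auto
    then show ?thesis by (simp add: prev_Suc)
  qed
  ultimately show ?thesis by simp
qed

lemma pin_weight_insert:
  assumes "finite A" "i \<ge> 1" "i \<notin> A" "Suc i \<in> A"
  shows "pin_weight K \<beta> s \<omega> (insert i A) * K (Suc i - prev_pt A i)
    = pin_weight K \<beta> s \<omega> A * (K (i - prev_pt A i) * K 1 * exp (\<beta> * \<omega> i + s))"
proof -
  have "exp (\<Sum>j\<in>insert i A. \<beta> * \<omega> j + s) = exp (\<beta> * \<omega> i + s) * exp (\<Sum>j\<in>A. \<beta> * \<omega> j + s)"
    using assms by (simp add: exp_add)
  then have "pin_weight K \<beta> s \<omega> (insert i A) * K (Suc i - prev_pt A i)
    = (renewal_prob K (insert i A) * K (Suc i - prev_pt A i)) *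
        (exp (\<beta> * \<omega> i + s) * exp (\<Sum>j\<in>A. \<beta> * \<omega> j + s))"
    by (simp add: pin_weight_def)
  then show ?thesis
    unfolding renewal_prob_insert[OF assms] by (simp add: pin_weight_def)
qed

definition flip_ratio :: "(nat \<Rightarrow> real) \<Rightarrow> real \<Rightarrow> real \<Rightarrow> (nat \<Rightarrow> real) \<Rightarrow> nat \<Rightarrow> real" where
  "flip_ratio K \<beta> s \<omega> k = (K 1)\<^sup>2 / K 2 * exp (\<beta> * \<omega> k + s)"

lemma pin_weight_insert_between:
  assumes "finite A" "k \<ge> 2" "k - 1 \<in> A" "k \<notin> A" "Suc k \<in> A" "K 2 > 0"
  shows "pin_weight K \<beta> s \<omega> (insert k A) = flip_ratio K \<beta> s \<omega> k * pin_weight K \<beta> s \<omega> A"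
proof -
  have "prev_pt A k = k - 1"
    by (rule prev_pt_eqI) (use assms in auto)
  moreover have "Suc k - (k - 1) = 2" "k - (k - 1) = 1" using assms by auto
  ultimately show ?thesis
    using pin_weight_insert[of A k K \<beta> s \<omega>] assms
    by (simp add: flip_ratio_def power2_eq_square field_simps)
qed

lemma pin_weight_le_insert:
  assumes Kpos: "\<And>n. n \<ge> 1 \<Longrightarrow> K n > 0" and B: "B > 0" "\<And>n. n \<ge> 1 \<Longrightarrow> K (Suc n) \<le> B * K n"
    and A: "A \<in> pin_conf N" "i \<ge> 1" "i \<notin> A" "Suc i \<in> A"
    and \<omega>: "- L \<le> \<beta> * \<omega> i + s"
  shows "pin_weight K \<beta> s \<omega> A \<le> B / K 1 * exp L * pin_weight K \<beta> s \<omega> (insert i A)"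
proof -
  define p where "p = prev_pt A i"
  have fin: "finite A" using A pin_confD by blast
  have p: "p < i" unfolding p_def by (rule prev_pt_less) (use fin A in auto)
  define u where "u = K (i - p)"
  define v where "v = K (Suc i - p)"
  have u: "u > 0" and v: "v > 0" "v \<le> B * u"
    using Kpos B(2)[of "i - p"] p by (auto simp: u_def v_def Suc_diff_le)
  have K1: "K 1 > 0" using Kpos by simp
  let ?W = "pin_weight K \<beta> s \<omega>"
  have W: "?W A > 0" using A Kpos by (intro pin_weight_pos)
  have eq: "?W (insert i A) * v = ?W A * (u * K 1 * exp (\<beta> * \<omega> i + s))"
    using pin_weight_insert[OF fin A(2-4), of K \<beta> s \<omega>] by (simp add: u_def v_def p_def)
  have "1 \<le> exp (L + (\<beta> * \<omega> i + s))" using \<omega> by simp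
  then have "?W A * v \<le> (?W A * v) * (exp L * exp (\<beta> * \<omega> i + s))"
    using W v by (simp add: exp_add)
  also have "\<dots> \<le> (?W A * (B * u)) * (exp L * exp (\<beta> * \<omega> i + s))"
    using W v by (intro mult_right_mono mult_left_mono) auto
  also have "\<dots> = B / K 1 * exp L * (?W A * (u * K 1 * exp (\<beta> * \<omega> i + s)))"
    using K1 by (simp add: field_simps)
  also have "\<dots> = B / K 1 * exp L * ?W (insert i A) * v"
    unfolding eq[symmetric] by simp
  finally show ?thesis using v(1) by (rule mult_right_le_imp_le)
qed

lemma sum_pin_conf_split:
  fixes g :: "nat set \<Rightarrow> real"
  assumes "1 \<le> k" "k < N"
  shows "(\<Sum>A\<in>pin_conf N. g A) = (\<Sum>A\<in>{A\<in>pin_conf N. k \<notin> A}. g A + g (insert k A))"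
proof -
  let ?S = "{A\<in>pin_conf N. k \<notin> A}"
  have "pin_conf N = ?S \<union> insert k ` ?S"
  proof (intro equalityI subsetI)
    fix A assume "A \<in> pin_conf N"
    then show "A \<in> ?S \<union> insert k ` ?S"
      using assms by (cases "k \<in> A")
        (auto simp: pin_conf_def insert_absorb intro!: image_eqI[of _ _ "A - {k}"])
  next
    fix A assume "A \<in> ?S \<union> insert k ` ?S"
    then show "A \<in> pin_conf N" using assms by (auto simp: pin_conf_def)
  qed
  moreover have "inj_on (insert k) ?S"
    by (rule inj_onI) (metis (mono_tags, lifting) insert_ident mem_Collect_eq)
  ultimately have "sum g (pin_conf N) = sum g ?S + sum (g \<circ> insert k) ?S"
    by (metis (no_types, lifting) finite_Un finite_pin_conf sum.union_disjoint sum.reindex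
        disjoint_iff imageE insertI1 mem_Collect_eq)
  then show ?thesis by (simp add: sum.distrib)
qed

lemma sum_pairs_nearest_neighbour_le:
  fixes e :: "nat \<Rightarrow> nat \<Rightarrow> real"
  assumes D: "finite D" and q: "\<And>k. k \<in> D \<Longrightarrow> q k \<ge> 0"
    and near: "\<And>k l. k \<in> D \<Longrightarrow> l \<in> D \<Longrightarrow> e k l \<le> (q k + q l) / 2"
    and far: "\<And>k l. k \<in> D \<Longrightarrow> l \<in> D \<Longrightarrow> l > Suc k \<or> k > Suc l \<Longrightarrow> e k l \<le> 0"
  shows "(\<Sum>k\<in>D. \<Sum>l\<in>D. e k l) \<le> 3 * (\<Sum>k\<in>D. q k)"
proof -
  let ?n = "\<lambda>k l. of_bool (l \<le> Suc k \<and> k \<le> Suc l) :: real"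
  have "(\<Sum>k\<in>D. \<Sum>l\<in>D. e k l) \<le> (\<Sum>k\<in>D. \<Sum>l\<in>D. ?n k l * (q k / 2) + ?n k l * (q l / 2))"
    by (intro sum_mono) (use near far in \<open>auto simp: not_le add_divide_distrib\<close>)
  also have "\<dots> = (\<Sum>k\<in>D. \<Sum>l\<in>D. ?n k l * (q k / 2)) + (\<Sum>k\<in>D. \<Sum>l\<in>D. ?n k l * (q l / 2))"
    by (simp add: sum.distrib)
  also have "(\<Sum>k\<in>D. \<Sum>l\<in>D. ?n k l * (q l / 2)) = (\<Sum>k\<in>D. \<Sum>l\<in>D. ?n k l * (q k / 2))"
    by (subst sum.swap) (simp add: conj_commute)
  also have "(\<Sum>k\<in>D. \<Sum>l\<in>D. ?n k l * (q k / 2)) + (\<Sum>k\<in>D. \<Sum>l\<in>D. ?n k l * (q k / 2))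
      = (\<Sum>k\<in>D. (\<Sum>l\<in>D. ?n k l) * q k)"
    by (simp add: sum_distrib_right mult.commute[of "q _"] flip: sum.distrib)
  also have "\<dots> \<le> (\<Sum>k\<in>D. 3 * q k)"
  proof (intro sum_mono mult_right_mono)
    fix k
    have "(\<Sum>l\<in>D. ?n k l) = real (card (D \<inter> {l. l \<le> Suc k \<and> k \<le> Suc l}))"
      using D by simp
    also have "card (D \<inter> {l. l \<le> Suc k \<and> k \<le> Suc l}) \<le> card {k - 1..Suc k}"
      by (rule card_mono) auto
    also have "card {k - 1..Suc k} \<le> 3" by simp
    finally show "(\<Sum>l\<in>D. ?n k l) \<le> 3" by simp
  qed (use q in auto)
  finally show ?thesis by (simp add: sum_distrib_left)
qed

locale pinning =
  fixes K :: "nat \<Rightarrow> real" and \<beta> s :: real and \<omega> :: "nat \<Rightarrow> real" and N :: nat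
  assumes Kpos: "\<And>n. n \<ge> 1 \<Longrightarrow> K n > 0" and N: "N \<ge> 1"
begin

abbreviation "W \<equiv> pin_weight K \<beta> s \<omega>"
abbreviation "r \<equiv> flip_ratio K \<beta> s \<omega>"

text \<open>\<open>Y k\<close> is orthogonal to every observable that does not depend on site \<open>k\<close>;
  its correlation with the number of contacts is \<open>U k\<close>.\<close>

definition Y :: "nat \<Rightarrow> nat set \<Rightarrow> real" where
  "Y k A = (if k - 1 \<in> A \<and> Suc k \<in> A then if k \<in> A then 1 else - r k else 0)"

definition U :: "nat \<Rightarrow> real" where
  "U k = (\<Sum>A\<in>pin_conf N. W A * of_bool (k - 1 \<in> A \<and> k \<in> A \<and> Suc k \<in> A))"

lemma W_pos: "A \<in> pin_conf N \<Longrightarrow> W A > 0"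
  using Kpos by (intro pin_weight_pos)

lemma U_nonneg: "U k \<ge> 0"
  unfolding U_def by (intro sum_nonneg) (simp add: less_imp_le W_pos)

lemma flip_test_orthogonal:
  assumes k: "2 \<le> k" "k < N"
    and f: "\<And>A. A \<in> pin_conf N \<Longrightarrow> k \<notin> A \<Longrightarrow> f (insert k A) = f A"
  shows "(\<Sum>A\<in>pin_conf N. W A * (Y k A * f A)) = 0"
proof -
  have "(\<Sum>A\<in>pin_conf N. W A * (Y k A * f A)) = (\<Sum>A\<in>{A\<in>pin_conf N. k \<notin> A}.
      W A * (Y k A * f A) + W (insert k A) * (Y k (insert k A) * f (insert k A)))"
    by (rule sum_pin_conf_split) (use k in auto)
  also have "\<dots> = 0"
  proof (rule sum.neutral, clarify)
    fix A assume A: "A \<in> pin_conf N" "k \<notin> A"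
    show "W A * (Y k A * f A) + W (insert k A) * (Y k (insert k A) * f (insert k A)) = 0"
      using pin_weight_insert_between[of A k K \<beta> s \<omega>] pin_confD[OF A(1)] A k f[OF A] Kpos[of 2]
      by (auto simp: Y_def)
  qed
  finally show ?thesis .
qed

lemma flip_test_card:
  assumes k: "2 \<le> k" "k < N"
  shows "(\<Sum>A\<in>pin_conf N. W A * (real (card A) * Y k A)) = U k"
proof -
  have "W A * (real (card A) * Y k A) = W A * (Y k A * real (card (A - {k})))
      + W A * of_bool (k - 1 \<in> A \<and> k \<in> A \<and> Suc k \<in> A)" if "A \<in> pin_conf N" for A
  proof (cases "k \<in> A")
    case True
    then have "card A = Suc (card (A - {k}))"
      using pin_confD[OF that] by (intro card.remove)
    then show ?thesis using True by (auto simp: Y_def algebra_simps)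
  qed auto
  then have "(\<Sum>A\<in>pin_conf N. W A * (real (card A) * Y k A))
      = (\<Sum>A\<in>pin_conf N. W A * (Y k A * real (card (A - {k})))) + U k"
    by (simp add: sum.distrib U_def)
  then show ?thesis by (subst (asm) flip_test_orthogonal[OF k]) auto
qed

lemma flip_test_square:
  assumes k: "2 \<le> k" "k < N"
  shows "(\<Sum>A\<in>pin_conf N. W A * (Y k A)\<^sup>2) = (1 + r k) * U k"
proof -
  define g where "g A = (1 + r k) * (W A * of_bool (k - 1 \<in> A \<and> k \<in> A \<and> Suc k \<in> A))" for A
  have k1: "1 \<le> k" using k by simp
  have "(\<Sum>A\<in>pin_conf N. W A * (Y k A)\<^sup>2) = (\<Sum>A\<in>{A\<in>pin_conf N. k \<notin> A}.
      W A * (Y k A)\<^sup>2 + W (insert k A) * (Y k (insert k A))\<^sup>2)"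
    by (rule sum_pin_conf_split[OF k1 k(2)])
  also have "\<dots> = (\<Sum>A\<in>{A\<in>pin_conf N. k \<notin> A}. g A + g (insert k A))"
  proof (rule sum.cong[OF refl], clarify)
    fix A assume A: "A \<in> pin_conf N" "k \<notin> A"
    then show "W A * (Y k A)\<^sup>2 + W (insert k A) * (Y k (insert k A))\<^sup>2 = g A + g (insert k A)"
      using pin_weight_insert_between[of A k K \<beta> s \<omega>] pin_confD[OF A(1)] k Kpos[of 2]
      by (auto simp: Y_def g_def power2_eq_square algebra_simps)
  qed
  also have "\<dots> = (\<Sum>A\<in>pin_conf N. g A)"
    by (rule sum_pin_conf_split[OF k1 k(2), symmetric])
  finally show ?thesis unfolding g_def U_def sum_distrib_left .
qed

lemma flip_test_far:
  assumes k: "2 \<le> k" "k < N" and l: "l \<ge> 1" "l > Suc k \<or> k > Suc l"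
  shows "(\<Sum>A\<in>pin_conf N. W A * (Y k A * Y l A)) = 0"
  by (rule flip_test_orthogonal[OF k]) (use l in \<open>auto simp: Y_def\<close>)

lemma variance_ge_triples:
  assumes D: "D \<subseteq> {2..<N}" and R: "\<And>k. k \<in> D \<Longrightarrow> r k \<le> R" "R \<ge> 0"
  shows "(\<Sum>A\<in>pin_conf N. W A * (real (card A))\<^sup>2) * (\<Sum>A\<in>pin_conf N. W A)
      - (\<Sum>A\<in>pin_conf N. W A * real (card A))\<^sup>2
    \<ge> (\<Sum>A\<in>pin_conf N. W A) * ((\<Sum>k\<in>D. U k) / (3 * (1 + R)))"
proof -
  let ?S = "pin_conf N"
  define a where "a = 1 / (3 * (1 + R))"
  define T where "T A = (\<Sum>k\<in>D. Y k A)" for A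
  have fin: "finite D" using D finite_subset by blast
  have k: "2 \<le> k" "k < N" if "k \<in> D" for k using D that by auto
  have T0: "(\<Sum>A\<in>?S. W A * T A) = 0"
  proof -
    have "(\<Sum>A\<in>?S. W A * T A) = (\<Sum>k\<in>D. \<Sum>A\<in>?S. W A * (Y k A * 1))"
      unfolding T_def sum_distrib_left by (subst sum.swap) simp
    also have "\<dots> = 0"
      by (intro sum.neutral ballI flip_test_orthogonal k) auto
    finally show ?thesis .
  qed
  have T1: "(\<Sum>A\<in>?S. W A * (real (card A) * T A)) = (\<Sum>k\<in>D. U k)"
  proof -
    have "(\<Sum>A\<in>?S. W A * (real (card A) * T A)) = (\<Sum>k\<in>D. \<Sum>A\<in>?S. W A * (real (card A) * Y k A))"
      unfolding T_def sum_distrib_left by (subst sum.swap) simp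
    also have "\<dots> = (\<Sum>k\<in>D. U k)"
      by (intro sum.cong flip_test_card k) auto
    finally show ?thesis .
  qed
  have T2: "(\<Sum>A\<in>?S. W A * (T A)\<^sup>2) \<le> 3 * ((1 + R) * (\<Sum>k\<in>D. U k))"
  proof -
    define e where "e k l = (\<Sum>A\<in>?S. W A * (Y k A * Y l A))" for k l
    have "(\<Sum>A\<in>?S. W A * (T A)\<^sup>2) = (\<Sum>A\<in>?S. \<Sum>k\<in>D. \<Sum>l\<in>D. W A * (Y k A * Y l A))"
      unfolding T_def power2_eq_square sum_product by (simp add: sum_distrib_left)
    also have "\<dots> = (\<Sum>k\<in>D. \<Sum>l\<in>D. e k l)"
      unfolding e_def by (subst sum.swap, intro sum.cong refl, subst sum.swap) simp
    also have "\<dots> \<le> 3 * (\<Sum>k\<in>D. e k k)"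
    proof (rule sum_pairs_nearest_neighbour_le[OF fin])
      show "e k k \<ge> 0" for k
        unfolding e_def using W_pos by (intro sum_nonneg) (simp add: less_imp_le)
      show "e k l \<le> (e k k + e l l) / 2" for k l
      proof -
        have "e k l \<le> (\<Sum>A\<in>?S. W A * ((Y k A * Y k A + Y l A * Y l A) / 2))"
          unfolding e_def
        proof (intro sum_mono mult_left_mono)
          fix A
          show "Y k A * Y l A \<le> (Y k A * Y k A + Y l A * Y l A) / 2"
            using sum_squares_bound[of "Y k A" "Y l A"] by (simp add: power2_eq_square)
        qed (use W_pos less_imp_le in auto)
        also have "\<dots> = (e k k + e l l) / 2"
          by (simp add: e_def sum.distrib distrib_left add_divide_distrib flip: sum_divide_distrib)
        finally show ?thesis .
      qed
      show "e k l \<le> 0" if "k \<in> D" "l \<in> D" "l > Suc k \<or> k > Suc l" for k l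
        unfolding e_def using flip_test_far[of k l] k[OF that(1)] k[OF that(2)] that(3)
        by simp
    qed
    also have "(\<Sum>k\<in>D. e k k) \<le> (\<Sum>k\<in>D. (1 + R) * U k)"
    proof (rule sum_mono)
      fix k assume kD: "k \<in> D"
      have "e k k = (1 + r k) * U k"
        unfolding e_def using flip_test_square[of k] k[OF kD]
        by (simp add: power2_eq_square)
      also have "\<dots> \<le> (1 + R) * U k"
        using R(1)[OF kD] U_nonneg[of k] by (intro mult_right_mono) auto
      finally show "e k k \<le> (1 + R) * U k" .
    qed
    finally show ?thesis by (simp add: sum_distrib_left)
  qed
  have "(\<Sum>k\<in>D. U k) / (3 * (1 + R)) = 2 * a * (\<Sum>k\<in>D. U k) - a\<^sup>2 * (3 * ((1 + R) * (\<Sum>k\<in>D. U k)))"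
  proof -
    have "a * (3 * (1 + R)) = 1" using R(2) by (simp add: a_def)
    then have "a\<^sup>2 * (3 * ((1 + R) * (\<Sum>k\<in>D. U k))) = a * (\<Sum>k\<in>D. U k)"
      by (metis (no_types, opaque_lifting) mult.assoc mult.left_neutral mult.commute power2_eq_square)
    then show ?thesis by (simp add: a_def)
  qed
  also have "\<dots> \<le> 2 * a * (\<Sum>k\<in>D. U k) - a\<^sup>2 * (\<Sum>A\<in>?S. W A * (T A)\<^sup>2)"
    using T2 by (intro diff_left_mono mult_left_mono) auto
  finally have "(\<Sum>A\<in>?S. W A) * ((\<Sum>k\<in>D. U k) / (3 * (1 + R)))
      \<le> (\<Sum>A\<in>?S. W A) * (2 * a * (\<Sum>k\<in>D. U k) - a\<^sup>2 * (\<Sum>A\<in>?S. W A * (T A)\<^sup>2))"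
    using W_pos by (intro mult_left_mono sum_nonneg) (auto intro: less_imp_le)
  also have "\<dots> \<le> (\<Sum>A\<in>?S. W A * (real (card A))\<^sup>2) * (\<Sum>A\<in>?S. W A)
      - (\<Sum>A\<in>?S. W A * real (card A))\<^sup>2"
    using gibbs_variance_ge[of ?S W T a "\<lambda>A. real (card A)"] W_pos T0 pin_conf_nonempty[OF N]
    unfolding T1 by simp
  finally show ?thesis .
qed

lemma sum_insert_le:
  assumes i: "1 \<le> i" "i < N" and C: "C \<ge> 0"
    and ins: "\<And>A. A \<in> pin_conf N \<Longrightarrow> i \<notin> A \<Longrightarrow> Suc i \<in> A \<Longrightarrow>
      W A \<le> C * W (insert i A)"
    and Q: "\<And>A. Q (insert i A) \<longleftrightarrow> Q A"
  shows "(\<Sum>A\<in>pin_conf N. W A * of_bool (Suc i \<in> A \<and> Q A))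
    \<le> (1 + C) * (\<Sum>A\<in>pin_conf N. W A * of_bool (i \<in> A \<and> Suc i \<in> A \<and> Q A))"
proof -
  define f where "f A = W A * of_bool (Suc i \<in> A \<and> Q A)" for A
  define g where "g A = (1 + C) * (W A * of_bool (i \<in> A \<and> Suc i \<in> A \<and> Q A))" for A
  have "(\<Sum>A\<in>pin_conf N. f A) = (\<Sum>A\<in>{A\<in>pin_conf N. i \<notin> A}. f A + f (insert i A))"
    by (rule sum_pin_conf_split[OF i])
  also have "\<dots> \<le> (\<Sum>A\<in>{A\<in>pin_conf N. i \<notin> A}. g A + g (insert i A))"
    using ins by (intro sum_mono) (auto simp: f_def g_def Q algebra_simps)
  also have "\<dots> = (\<Sum>A\<in>pin_conf N. g A)"
    by (rule sum_pin_conf_split[OF i, symmetric])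
  finally show ?thesis unfolding f_def g_def sum_distrib_left .
qed

lemma U_ge:
  assumes B: "B > 0" "\<And>n. n \<ge> 1 \<Longrightarrow> K (Suc n) \<le> B * K n"
    and k: "2 \<le> k" "k < N" and L: "- L \<le> \<beta> * \<omega> k + s" "- L \<le> \<beta> * \<omega> (k - 1) + s"
  shows "(\<Sum>A\<in>pin_conf N. W A * of_bool (Suc k \<in> A))
    \<le> (1 + B / K 1 * exp L)\<^sup>2 * U k"
proof -
  let ?C = "B / K 1 * exp L"
  have C: "?C \<ge> 0" using B Kpos[of 1] by simp
  have ins: "W A \<le> ?C * W (insert i A)"
    if "A \<in> pin_conf N" "i \<notin> A" "Suc i \<in> A" "i \<in> {k - 1, k}" for A i
    by (rule pin_weight_le_insert[where N = N]) (use that k L Kpos B in auto)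
  have "(\<Sum>A\<in>pin_conf N. W A * of_bool (Suc k \<in> A \<and> True))
      \<le> (1 + ?C) * (\<Sum>A\<in>pin_conf N. W A * of_bool (k \<in> A \<and> Suc k \<in> A \<and> True))"
    by (rule sum_insert_le) (use k C ins in auto)
  also have "\<dots> = (1 + ?C) * (\<Sum>A\<in>pin_conf N. W A * of_bool (Suc (k - 1) \<in> A \<and> Suc k \<in> A))"
    using k by simp
  also have "\<dots> \<le> (1 + ?C) * ((1 + ?C) *
      (\<Sum>A\<in>pin_conf N. W A * of_bool (k - 1 \<in> A \<and> Suc (k - 1) \<in> A \<and> Suc k \<in> A)))"
    by (intro mult_left_mono sum_insert_le) (use k C ins in auto)
  finally show ?thesis using k by (simp add: U_def power2_eq_square)
qed

lemma variance_ge_mean: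
  assumes B: "B > 0" "\<And>n. n \<ge> 1 \<Longrightarrow> K (Suc n) \<le> B * K n" and \<beta>: "\<beta> \<ge> 0"
    and s: "- L \<le> s - \<beta> * M" "\<beta> * M + s \<le> L"
  shows "((\<Sum>A\<in>pin_conf N. W A * (real (card A))\<^sup>2) * (\<Sum>A\<in>pin_conf N. W A)
      - (\<Sum>A\<in>pin_conf N. W A * real (card A))\<^sup>2) / (\<Sum>A\<in>pin_conf N. W A)\<^sup>2
    \<ge> ((\<Sum>A\<in>pin_conf N. W A * real (card A)) / (\<Sum>A\<in>pin_conf N. W A)
        - 2 - 2 * real (card {i\<in>{1..N}. \<bar>\<omega> i\<bar> > M}))
      / (3 * (1 + (K 1)\<^sup>2 / K 2 * exp L) * (1 + B / K 1 * exp L)\<^sup>2)"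
proof -
  define Z where "Z = (\<Sum>A\<in>pin_conf N. W A)"
  have Z: "Z > 0"
    unfolding Z_def using pin_conf_nonempty[OF N] W_pos by (intro sum_pos) auto
  define bad where "bad = {i\<in>{1..N}. \<bar>\<omega> i\<bar> > M}"
  define D where "D = {k\<in>{2..<N}. k \<notin> bad \<and> k - 1 \<notin> bad}"
  define R where "R = (K 1)\<^sup>2 / K 2 * exp L"
  define C where "C = 1 + B / K 1 * exp L"
  define T where "T j = (\<Sum>A\<in>pin_conf N. W A * of_bool (j \<in> A))" for j
  have K12: "K 1 > 0" "K 2 > 0" using Kpos by auto
  have R: "R \<ge> 0" and C: "C > 0" using K12 B(1) by (auto simp: R_def C_def intro!: add_pos_nonneg)
  have bnd: "- L \<le> \<beta> * \<omega> i + s" "\<beta> * \<omega> i + s \<le> L" if "i \<in> {1..N}" "i \<notin> bad" for i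
  proof -
    have "\<bar>\<omega> i\<bar> \<le> M" using that by (auto simp: bad_def)
    then have "\<beta> * \<omega> i \<le> \<beta> * M" "\<beta> * (- M) \<le> \<beta> * \<omega> i"
      by (intro mult_left_mono \<beta>; linarith)+
    then show "- L \<le> \<beta> * \<omega> i + s" "\<beta> * \<omega> i + s \<le> L" using s by auto
  qed
  have var: "(\<Sum>A\<in>pin_conf N. W A * (real (card A))\<^sup>2) * Z
      - (\<Sum>A\<in>pin_conf N. W A * real (card A))\<^sup>2 \<ge> Z * ((\<Sum>k\<in>D. U k) / (3 * (1 + R)))"
    unfolding Z_def
  proof (rule variance_ge_triples)
    show "r k \<le> R" if "k \<in> D" for k
      unfolding flip_ratio_def R_def using that K12 bnd(2)[of k]
      by (intro mult_left_mono) (auto simp: D_def)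
  qed (use R in \<open>auto simp: D_def\<close>)
  have mean: "(\<Sum>A\<in>pin_conf N. W A * real (card A)) = (\<Sum>j=1..N. T j)"
  proof -
    have "real (card A) = (\<Sum>j=1..N. of_bool (j \<in> A))" if "A \<in> pin_conf N" for A
      using pin_confD(2)[OF that] by (simp add: Int_absorb1)
    then show ?thesis
      unfolding T_def by (subst sum.swap) (simp flip: sum_distrib_left)
  qed
  have T_le: "T j \<le> Z" for j
    unfolding T_def Z_def using W_pos by (intro sum_mono) (auto simp: less_imp_le)
  have card_le: "real (card ({1..N} - Suc ` D)) \<le> 2 + 2 * real (card bad)"
  proof -
    have fin: "finite bad" by (simp add: bad_def)
    have "{1..N} - Suc ` D \<subseteq> {1, 2} \<union> (Suc ` bad \<union> (Suc \<circ> Suc) ` bad)"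
    proof
      fix j assume j: "j \<in> {1..N} - Suc ` D"
      show "j \<in> {1, 2} \<union> (Suc ` bad \<union> (Suc \<circ> Suc) ` bad)"
      proof (cases "j \<le> 2")
        case False
        define i where "i = j - 2"
        have i: "j = Suc (Suc i)" "i \<ge> 1" using False by (auto simp: i_def)
        then have "Suc i \<notin> D" using j by auto
        then have "Suc i \<in> bad \<or> i \<in> bad" using i j by (auto simp: D_def)
        then show ?thesis using i by auto
      qed (use j in auto)
    qed
    then have "card ({1..N} - Suc ` D) \<le> card ({1, 2} \<union> (Suc ` bad \<union> (Suc \<circ> Suc) ` bad))"
      by (intro card_mono) (use fin in auto)
    also have "\<dots> \<le> card {1, 2::nat} + (card (Suc ` bad) + card ((Suc \<circ> Suc) ` bad))"
      by (rule order_trans[OF card_Un_le add_left_mono[OF card_Un_le]])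
    also have "\<dots> \<le> 2 + (card bad + card bad)"
      by (intro add_mono card_image_le fin) simp
    finally show ?thesis by simp
  qed
  have "(\<Sum>j=1..N. T j) = (\<Sum>j\<in>Suc ` D. T j) + (\<Sum>j\<in>{1..N} - Suc ` D. T j)"
    by (subst add.commute, rule sum.subset_diff) (auto simp: D_def)
  also have "(\<Sum>j\<in>{1..N} - Suc ` D. T j) \<le> real (card ({1..N} - Suc ` D)) * Z"
    by (rule sum_bounded_above) (use T_le in auto)
  also have "\<dots> \<le> (2 + 2 * real (card bad)) * Z"
    using card_le Z by (intro mult_right_mono) auto
  also have "(\<Sum>j\<in>Suc ` D. T j) = (\<Sum>k\<in>D. T (Suc k))"
    by (subst sum.reindex) auto
  also have "\<dots> \<le> (\<Sum>k\<in>D. C\<^sup>2 * U k)"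
    unfolding T_def C_def
    by (intro sum_mono U_ge B bnd) (auto simp: D_def)
  also have "\<dots> = C\<^sup>2 * (\<Sum>k\<in>D. U k)" by (simp add: sum_distrib_left)
  finally have "(\<Sum>j=1..N. T j) - (2 + 2 * real (card bad)) * Z \<le> C\<^sup>2 * (\<Sum>k\<in>D. U k)"
    by simp
  then have "((\<Sum>j=1..N. T j) / Z - 2 - 2 * real (card bad)) / C\<^sup>2 \<le> (\<Sum>k\<in>D. U k) / Z"
  proof -
    assume le: "(\<Sum>j=1..N. T j) - (2 + 2 * real (card bad)) * Z \<le> C\<^sup>2 * (\<Sum>k\<in>D. U k)"
    have "(\<Sum>j=1..N. T j) / Z - 2 - 2 * real (card bad)
        = ((\<Sum>j=1..N. T j) - (2 + 2 * real (card bad)) * Z) / Z"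
      using Z by (simp add: field_simps)
    also have "\<dots> \<le> C\<^sup>2 * (\<Sum>k\<in>D. U k) / Z"
      using le Z by (intro divide_right_mono) auto
    finally show ?thesis using C by (simp add: divide_le_eq mult.commute)
  qed
  then have "((\<Sum>j=1..N. T j) / Z - 2 - 2 * real (card bad)) / C\<^sup>2 / (3 * (1 + R))
      \<le> (\<Sum>k\<in>D. U k) / Z / (3 * (1 + R))"
    using R by (intro divide_right_mono) auto
  also have "\<dots> = Z * ((\<Sum>k\<in>D. U k) / (3 * (1 + R))) / Z\<^sup>2"
    using Z by (simp add: power2_eq_square)
  also have "\<dots> \<le> ((\<Sum>A\<in>pin_conf N. W A * (real (card A))\<^sup>2) * Z
      - (\<Sum>A\<in>pin_conf N. W A * real (card A))\<^sup>2) / Z\<^sup>2"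
    using var by (intro divide_right_mono) auto
  finally show ?thesis
    unfolding Z_def[symmetric] bad_def[symmetric] R_def[symmetric] C_def[symmetric] mean
    by (simp add: mult.commute)
qed

end

section \<open>Bounds on the free energy\<close>

lemma pin_Z_pos:
  assumes "\<And>n. n \<ge> 1 \<Longrightarrow> K n > 0" "N \<ge> 1"
  shows "pin_Z K \<beta> s \<omega> N > 0"
  unfolding pin_Z_eq using assms pin_conf_nonempty by (intro sum_pos) (auto intro: pin_weight_pos)

lemma ln_pin_Z_symmetric_difference_ge:
  fixes K \<omega> :: "nat \<Rightarrow> real"
  defines "\<phi> \<equiv> \<lambda>\<beta> N s. ln (pin_Z K \<beta> s \<omega> N)"
  assumes Kpos: "\<And>n. n \<ge> 1 \<Longrightarrow> K n > 0" and N: "N \<ge> 1"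
    and B: "B > 0" "\<And>n. n \<ge> 1 \<Longrightarrow> K (Suc n) \<le> B * K n" and \<beta>: "\<beta> \<ge> 0"
    and h: "h\<^sub>0 < h'" "h' \<le> h - t" "t \<ge> 0" "h + t \<le> h\<^sub>1"
    and L: "- L \<le> h' - \<beta> * M" "\<beta> * M + h\<^sub>1 \<le> L"
    and slope: "x * (h' - h\<^sub>0) \<le> \<phi> \<beta> N h' - \<phi> \<beta> N h\<^sub>0"
  shows "\<phi> \<beta> N (h + t) + \<phi> \<beta> N (h - t) - 2 * \<phi> \<beta> N h
    \<ge> (x - 2 - 2 * real (card {i\<in>{1..N}. \<bar>\<omega> i\<bar> > M}))
      / (3 * (1 + (K 1)\<^sup>2 / K 2 * exp L) * (1 + B / K 1 * exp L)\<^sup>2) * t\<^sup>2"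
proof -
  let ?S = "pin_conf N"
  let ?W = "\<lambda>s. pin_weight K \<beta> s \<omega>"
  define w where "w = ?W 0"
  define c :: "nat set \<Rightarrow> real" where "c A = real (card A)" for A
  have w: "w A > 0" if "A \<in> ?S" for A unfolding w_def using that Kpos by (rule pin_weight_pos)
  have W: "?W s A > 0" if "A \<in> ?S" for A s using that Kpos by (rule pin_weight_pos)
  have shift: "?W s A = w A * exp (s * c A)" for s A
    unfolding c_def w_def by (rule pin_weight_shift)
  define \<phi>' where "\<phi>' s = (\<Sum>A\<in>?S. ?W s A * c A) / (\<Sum>A\<in>?S. ?W s A)" for s
  define \<phi>'' where "\<phi>'' s = ((\<Sum>A\<in>?S. ?W s A * (c A)\<^sup>2) * (\<Sum>A\<in>?S. ?W s A)
      - (\<Sum>A\<in>?S. ?W s A * c A)\<^sup>2) / (\<Sum>A\<in>?S. ?W s A)\<^sup>2" for s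
  have d1: "(\<phi> \<beta> N has_real_derivative \<phi>' s) (at s)" for s
    unfolding \<phi>_def pin_Z_eq \<phi>'_def shift
    by (rule DERIV_ln_partition_sum) (use w pin_conf_nonempty[OF N] in auto)
  have d2: "(\<phi>' has_real_derivative \<phi>'' s) (at s)" for s
    unfolding \<phi>'_def \<phi>''_def shift
    by (rule DERIV_gibbs_mean) (use w pin_conf_nonempty[OF N] in auto)
  have nonneg: "\<phi>'' s \<ge> 0" for s
    unfolding \<phi>''_def
    using gibbs_variance_ge[of ?S "?W s" "\<lambda>_. 0" 0 c] W pin_conf_nonempty[OF N]
    by (intro divide_nonneg_nonneg) auto
  have mono: "\<phi>' a \<le> \<phi>' b" if "a \<le> b" for a b
    using that by (rule DERIV_nonneg_imp_nondecreasing) (use d2 nonneg in blast)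
  have ge_x: "x \<le> \<phi>' s" if "s \<ge> h'" for s
  proof -
    obtain z where z: "h\<^sub>0 < z" "z < h'" "\<phi> \<beta> N h' - \<phi> \<beta> N h\<^sub>0 = (h' - h\<^sub>0) * \<phi>' z"
      using MVT2[of h\<^sub>0 h' "\<phi> \<beta> N" \<phi>'] h(1) d1 by blast
    have "x * (h' - h\<^sub>0) \<le> \<phi>' z * (h' - h\<^sub>0)" using slope z(3) by (simp add: mult.commute)
    then have "x \<le> \<phi>' z" using h(1) by simp
    also have "\<phi>' z \<le> \<phi>' s" using z that by (intro mono) simp
    finally show ?thesis .
  qed
  define \<kappa> where "\<kappa> = 3 * (1 + (K 1)\<^sup>2 / K 2 * exp L) * (1 + B / K 1 * exp L)\<^sup>2"
  have \<kappa>: "\<kappa> \<ge> 0" unfolding \<kappa>_def using Kpos[of 1] Kpos[of 2] by simp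
  show ?thesis
    unfolding \<kappa>_def[symmetric]
  proof (rule symmetric_difference_ge[OF d1 d2 _ h(3)])
    fix s assume s: "s \<in> {h - t..h + t}"
    interpret pinning K \<beta> s \<omega> N using Kpos N by unfold_locales
    let ?b = "real (card {i\<in>{1..N}. \<bar>\<omega> i\<bar> > M})"
    have "(x - 2 - 2 * ?b) / \<kappa> \<le> (\<phi>' s - 2 - 2 * ?b) / \<kappa>"
      using ge_x[of s] s h(2) \<kappa> by (intro divide_right_mono) auto
    also have "\<dots> \<le> \<phi>'' s"
      unfolding \<kappa>_def \<phi>'_def \<phi>''_def c_def
      by (rule variance_ge_mean[OF B \<beta>]) (use s h L in auto)
    finally show "(x - 2 - 2 * ?b) / \<kappa> \<le> \<phi>'' s" .
  qed
qed

lemma ln_pin_Z_le: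
  assumes Kpos: "\<And>n. n \<ge> 1 \<Longrightarrow> K n > 0" and K1: "\<And>n. K n \<le> 1" and N: "N \<ge> 1"
  shows "ln (pin_Z K \<beta> s \<omega> N) \<le> exp s * (\<Sum>j=1..N. exp (\<beta> * \<omega> j))"
proof -
  have "pin_Z K \<beta> s \<omega> N \<le> (\<Sum>A\<in>pin_conf N. \<Prod>j\<in>A. exp (\<beta> * \<omega> j + s))"
    unfolding pin_Z_eq
  proof (rule sum_mono)
    fix A assume A: "A \<in> pin_conf N"
    have "renewal_prob K A \<le> 1"
      unfolding renewal_prob_def
    proof (rule prod_le_1, safe)
      fix j assume "j \<in> A"
      then have "prev_pt A j < j" using pin_confD[OF A] by (intro prev_pt_less) auto
      then show "K (j - prev_pt A j) \<ge> 0" using Kpos[of "j - prev_pt A j"] by linarith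
    qed (rule K1)
    then have "pin_weight K \<beta> s \<omega> A \<le> 1 * exp (\<Sum>j\<in>A. \<beta> * \<omega> j + s)"
      unfolding pin_weight_def by (intro mult_right_mono) auto
    then show "pin_weight K \<beta> s \<omega> A \<le> (\<Prod>j\<in>A. exp (\<beta> * \<omega> j + s))"
      using pin_confD[OF A] by (simp add: exp_sum)
  qed
  also have "\<dots> \<le> (\<Sum>A\<in>Pow {1..N}. \<Prod>j\<in>A. exp (\<beta> * \<omega> j + s))"
    by (rule sum_mono2) (auto simp: pin_conf_def intro!: prod_nonneg)
  also have "\<dots> = (\<Prod>j\<in>{1..N}. exp (\<beta> * \<omega> j + s) + 1)"
    by (subst prod_add) auto
  also have "\<dots> \<le> (\<Prod>j\<in>{1..N}. exp (exp (\<beta> * \<omega> j + s)))"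
    by (intro prod_mono) (auto intro: add_nonneg_nonneg simp: add.commute)
  also have "\<dots> = exp (exp s * (\<Sum>j=1..N. exp (\<beta> * \<omega> j)))"
    by (simp add: exp_sum exp_add sum_distrib_left mult.commute)
  finally show ?thesis
    using pin_Z_pos[where K = K, OF Kpos N] by (metis exp_gt_zero ln_exp ln_le_cancel_iff)
qed

lemma ln_pin_Z_ge:
  assumes Kpos: "\<And>n. n \<ge> 1 \<Longrightarrow> K n > 0" and N: "N \<ge> 1"
  shows "ln (pin_Z K \<beta> s \<omega> N) \<ge> real N * (ln (K 1) + s) + (\<Sum>j=1..N. \<beta> * \<omega> j)"
proof -
  have A: "{1..N} \<in> pin_conf N" using N by (simp add: pin_conf_def)
  have "renewal_prob K {1..N} = (\<Prod>j\<in>{1..N}. K 1)"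
    unfolding renewal_prob_def
  proof (rule prod.cong[OF refl])
    fix j assume j: "j \<in> {1..N}"
    then have "prev_pt {1..N} j = j - 1" by (intro prev_pt_eqI) auto
    then show "K (j - prev_pt {1..N} j) = K 1" using j by simp
  qed
  also have "\<dots> = exp (real N * ln (K 1))"
    using Kpos[of 1] by (simp add: exp_of_nat_mult)
  finally have "exp (real N * (ln (K 1) + s) + (\<Sum>j=1..N. \<beta> * \<omega> j)) = pin_weight K \<beta> s \<omega> {1..N}"
    by (simp add: pin_weight_def sum.distrib distrib_left flip: exp_add)
  also have "\<dots> \<le> pin_Z K \<beta> s \<omega> N"
    unfolding pin_Z_eq
    using pin_weight_pos[where K = K, OF _ Kpos] A
    by (intro member_le_sum[where f = "pin_weight K \<beta> s \<omega>"]) (auto intro: less_imp_le)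
  finally show ?thesis using pin_Z_pos[where K = K, OF Kpos N] by (simp add: ln_ge_iff)
qed

lemma tendsto_frequently_le:
  fixes X :: "'a \<Rightarrow> real"
  assumes "(X \<longlongrightarrow> l) F" "\<exists>\<^sub>F n in F. X n \<le> c"
  shows "l \<le> c"
proof (rule ccontr)
  assume "\<not> l \<le> c"
  then have "\<forall>\<^sub>F n in F. c < X n" using assms(1) by (intro order_tendstoD) auto
  from frequently_eventually_conj[OF assms(2) this] show False
    by (auto dest: frequently_ex)
qed

lemma AE_tendsto_free_energy:
  assumes "prob_space \<mu>" and "\<exists>f. AE \<omega> in PiM UNIV (\<lambda>_. \<mu>).
      (\<lambda>N. ln (pin_Z K \<beta> y \<omega> N) / real N) \<longlonglongrightarrow> f"
  shows "AE \<omega> in PiM UNIV (\<lambda>_. \<mu>).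
      (\<lambda>N. ln (pin_Z K \<beta> y \<omega> N) / real N) \<longlonglongrightarrow> free_energy K \<mu> \<beta> y"
proof -
  interpret prob_space "PiM UNIV (\<lambda>_::nat. \<mu>)" by (intro prob_space_PiM assms)
  let ?P = "\<lambda>f. AE \<omega> in PiM UNIV (\<lambda>_. \<mu>). (\<lambda>N. ln (pin_Z K \<beta> y \<omega> N) / real N) \<longlonglongrightarrow> f"
  have "\<exists>!f. ?P f"
  proof (rule ex_ex1I)
    fix f g assume "?P f" "?P g"
    then have "AE \<omega> in PiM UNIV (\<lambda>_::nat. \<mu>). f = g"
      by eventually_elim (rule LIMSEQ_unique)
    then show "f = g" by simp
  qed fact
  then show ?thesis unfolding free_energy_def by (rule theI')
qed

theorem theoremB1:
  fixes K :: "nat \<Rightarrow> real" and \<mu> :: "real measure"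
    and \<alpha> C\<^sub>K \<beta> h :: real
  assumes K0: "K 0 = 0"
    and Kpos: "\<And>n. n \<ge> 1 \<Longrightarrow> K n > 0"
    and Ksum: "K sums 1"
    and alpha: "\<alpha> > 0" and CK: "C\<^sub>K > 0"
    and Kasymp: "K \<sim>[at_top] (\<lambda>n. C\<^sub>K * real n powr (-(1 + \<alpha>)))"
    and mu_prob: "prob_space \<mu>" and mu_borel: "sets \<mu> = sets borel"
    and expmom: "\<And>s. integrable \<mu> (\<lambda>x. exp (s * x))"
    and mean0: "(\<integral>x. x \<partial>\<mu>) = 0"
    and var1: "(\<integral>x. x\<^sup>2 \<partial>\<mu>) = 1"
    and fe_exists: "\<And>b y. \<exists>f. AE \<omega> in PiM UNIV (\<lambda>_. \<mu>).
                       (\<lambda>N. ln (pin_Z K b y \<omega> N) / real N) \<longlonglongrightarrow> f"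
    and fe_smooth: "\<And>b y. y > crit_h K \<mu> b \<Longrightarrow>
                       free_energy K \<mu> b differentiable at y \<and>
                       deriv (free_energy K \<mu> b) differentiable at y"
    and beta: "\<beta> \<ge> 0"
    and hgt: "h > crit_h K \<mu> \<beta>"
  shows "deriv (deriv (free_energy K \<mu> \<beta>)) h > 0"
proof -
  let ?F = "free_energy K \<mu> \<beta>"
  let ?X = "\<lambda>\<omega> y N. ln (pin_Z K \<beta> y \<omega> N) / real N"
  have lim: "AE \<omega> in PiM UNIV (\<lambda>_. \<mu>). ?X \<omega> y \<longlonglongrightarrow> ?F y" for y
    by (rule AE_tendsto_free_energy[OF mu_prob fe_exists])
  have Knonneg: "K n \<ge> 0" for n using Kpos[of n] K0 by (cases n) (auto intro: less_imp_le)
  have Kle1: "K n \<le> 1" for n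
    using sum_le_suminf[of K "{n}"] Ksum Knonneg by (simp add: sums_iff)
  have sq: "integrable \<mu> (\<lambda>x. x\<^sup>2)"
    using var1 not_integrable_integral_eq by fastforce
  obtain B where B: "B > 0" "\<And>n. n \<ge> 1 \<Longrightarrow> K (Suc n) \<le> B * K n"
    using bounded_ratio_of_power_asymp[OF Kpos CK Kasymp] by blast
  note square_avg = exists_AE_frequently_avg_le[OF mu_prob sq zero_le_power2, of 2, unfolded var1]

  have "\<exists>y. ?F y > 0"
  proof -
    define y where "y = 1 + 3 * \<beta> - ln (K 1)"
    obtain \<omega> where \<omega>: "?X \<omega> y \<longlonglongrightarrow> ?F y"
      and freq: "\<exists>\<^sub>F N in sequentially. (\<Sum>j=1..N. (\<omega> j)\<^sup>2) \<le> 2 * real N"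
      using square_avg[OF _ _ lim[of y]] by auto
    have "\<exists>\<^sub>F N in sequentially. - ?X \<omega> y N \<le> - 1"
      using frequently_eventually_conj[OF freq eventually_ge_at_top[of 1]]
    proof (rule frequently_elim1, elim conjE)
      fix N :: nat assume N: "1 \<le> N" and le: "(\<Sum>j=1..N. (\<omega> j)\<^sup>2) \<le> 2 * real N"
      have "- (\<Sum>j=1..N. \<beta> * \<omega> j) = (\<Sum>j=1..N. \<beta> * (- \<omega> j))" by (simp add: sum_negf)
      also have "\<dots> \<le> (\<Sum>j=1..N. \<beta> * (1 + (\<omega> j)\<^sup>2))"
      proof (intro sum_mono mult_left_mono beta)
        fix j
        have "0 \<le> (\<omega> j + 1/2)\<^sup>2" by simp
        then show "- \<omega> j \<le> 1 + (\<omega> j)\<^sup>2" by (simp add: power2_eq_square algebra_simps)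
      qed
      also have "\<dots> = \<beta> * (real N + (\<Sum>j=1..N. (\<omega> j)\<^sup>2))"
        by (simp add: sum.distrib flip: sum_distrib_left)
      also have "\<dots> \<le> \<beta> * (3 * real N)" using le beta by (intro mult_left_mono) auto
      finally have "real N * (ln (K 1) + y) - 3 * \<beta> * real N \<le> ln (pin_Z K \<beta> y \<omega> N)"
        using ln_pin_Z_ge[where K = K and \<beta> = \<beta> and s = y and \<omega> = \<omega>, OF Kpos N] by simp
      then have "real N \<le> ln (pin_Z K \<beta> y \<omega> N)" by (simp add: y_def algebra_simps)
      then show "- ?X \<omega> y N \<le> - 1" using N by simp
    qed
    then have "- ?F y \<le> - 1" by (rule tendsto_frequently_le[OF tendsto_minus[OF \<omega>]])
    then show ?thesis by (intro exI[of _ y]) simp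
  qed
  then have "{y. ?F y > 0} \<noteq> {}" by auto
  then obtain h' where h': "?F h' > 0" "h' < h"
    using cInf_lessD[of "{y. ?F y > 0}" h] hgt unfolding crit_h_def by auto

  define c where "c = 2 * (\<integral>x. exp (\<beta> * x) \<partial>\<mu>) + 1"
  have c: "c > 0" by (simp add: c_def add_nonneg_pos integral_nonneg)
  have F_le: "?F y \<le> c * exp y" for y
  proof -
    obtain \<omega> where \<omega>: "?X \<omega> y \<longlonglongrightarrow> ?F y"
      and freq: "\<exists>\<^sub>F N in sequentially. (\<Sum>j=1..N. exp (\<beta> * \<omega> j)) \<le> c * real N"
      using exists_AE_frequently_avg_le[OF mu_prob expmom[of \<beta>] _ c _ lim[of y]]
      by (auto simp: c_def)
    have "\<exists>\<^sub>F N in sequentially. ?X \<omega> y N \<le> c * exp y"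
      using frequently_eventually_conj[OF freq eventually_ge_at_top[of 1]]
    proof (rule frequently_elim1, elim conjE)
      fix N :: nat assume N: "1 \<le> N" and le: "(\<Sum>j=1..N. exp (\<beta> * \<omega> j)) \<le> c * real N"
      have "ln (pin_Z K \<beta> y \<omega> N) \<le> exp y * (c * real N)"
        using ln_pin_Z_le[where K = K and \<beta> = \<beta> and s = y and \<omega> = \<omega>, OF Kpos Kle1 N] le
        by (meson exp_ge_zero mult_left_mono order_trans)
      then show "?X \<omega> y N \<le> c * exp y" using N by (simp add: field_simps)
    qed
    then show ?thesis by (rule tendsto_frequently_le[OF \<omega>])
  qed
  define h\<^sub>0 where "h\<^sub>0 = min (h' - 1) (ln (?F h' / (2 * c)))"
  have h0: "h\<^sub>0 < h'" by (simp add: h\<^sub>0_def)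
  have "?F h\<^sub>0 < ?F h'"
  proof -
    have "exp h\<^sub>0 \<le> exp (ln (?F h' / (2 * c)))" by (simp add: h\<^sub>0_def)
    also have "\<dots> = ?F h' / (2 * c)" using h'(1) c by simp
    finally have "c * exp h\<^sub>0 \<le> c * (?F h' / (2 * c))" using c by (intro mult_left_mono) auto
    also have "\<dots> = ?F h' / 2" using c by simp
    finally show ?thesis using F_le[of h\<^sub>0] h'(1) by linarith
  qed
  define \<eta> where "\<eta> = (?F h' - ?F h\<^sub>0) / (2 * (h' - h\<^sub>0))"
  have \<eta>: "\<eta> > 0" using h0 \<open>?F h\<^sub>0 < ?F h'\<close> by (simp add: \<eta>_def)
  define M where "M = 4 / sqrt \<eta>"
  have M: "M > 0" "M\<^sup>2 = 16 / \<eta>" using \<eta> by (auto simp: M_def power_divide)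
  define L where "L = \<bar>h'\<bar> + \<bar>h + 1\<bar> + \<beta> * M"
  define \<kappa> where "\<kappa> = 3 * (1 + (K 1)\<^sup>2 / K 2 * exp L) * (1 + B / K 1 * exp L)\<^sup>2"
  have \<kappa>: "\<kappa> > 0"
    unfolding \<kappa>_def using Kpos[of 1] Kpos[of 2] B(1)
    by (intro mult_pos_pos zero_less_power add_pos_nonneg) auto
  have "\<eta> / 2 / \<kappa> * t\<^sup>2 \<le> ?F (h + t) + ?F (h - t) - 2 * ?F h"
    if t: "0 < t" "t < min 1 (h - h')" for t
  proof -
    have "AE \<omega> in PiM UNIV (\<lambda>_. \<mu>). \<forall>y\<in>{h\<^sub>0, h', h - t, h, h + t}. ?X \<omega> y \<longlonglongrightarrow> ?F y"
      using lim[of h\<^sub>0] lim[of h'] lim[of "h - t"] lim[of h] lim[of "h + t"]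
      by eventually_elim auto
    from square_avg[OF _ _ this] obtain \<omega> where
      \<omega>: "\<And>y. y \<in> {h\<^sub>0, h', h - t, h, h + t} \<Longrightarrow> ?X \<omega> y \<longlonglongrightarrow> ?F y"
      and freq: "\<exists>\<^sub>F N in sequentially. (\<Sum>j=1..N. (\<omega> j)\<^sup>2) \<le> 2 * real N"
      by auto
    have "(\<lambda>N. ?X \<omega> h' N - ?X \<omega> h\<^sub>0 N) \<longlonglongrightarrow> ?F h' - ?F h\<^sub>0"
      by (intro tendsto_diff \<omega>) auto
    moreover have "\<eta> * (h' - h\<^sub>0) < ?F h' - ?F h\<^sub>0"
    proof -
      have "?F h' - ?F h\<^sub>0 = 2 * (\<eta> * (h' - h\<^sub>0))" using h0 by (simp add: \<eta>_def field_simps)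
      then show ?thesis using mult_pos_pos[OF \<eta>, of "h' - h\<^sub>0"] h0 by linarith
    qed
    ultimately have slope: "\<forall>\<^sub>F N in sequentially. \<eta> * (h' - h\<^sub>0) < ?X \<omega> h' N - ?X \<omega> h\<^sub>0 N"
      by (rule order_tendstoD)
    have "\<forall>\<^sub>F N in sequentially. N \<ge> max 1 (nat \<lceil>8 / \<eta>\<rceil>)" by (rule eventually_ge_at_top)
    with slope have "\<forall>\<^sub>F N in sequentially. \<eta> * (h' - h\<^sub>0) < ?X \<omega> h' N - ?X \<omega> h\<^sub>0 N
        \<and> N \<ge> max 1 (nat \<lceil>8 / \<eta>\<rceil>)"
      by (rule eventually_conj)
    from frequently_eventually_conj[OF freq this]
    have "\<exists>\<^sub>F N in sequentially.
        2 * ?X \<omega> h N - ?X \<omega> (h + t) N - ?X \<omega> (h - t) N \<le> - (\<eta> / 2 / \<kappa> * t\<^sup>2)"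
    proof (rule frequently_elim1, elim conjE)
      fix N :: nat
      assume slope: "\<eta> * (h' - h\<^sub>0) < ?X \<omega> h' N - ?X \<omega> h\<^sub>0 N"
        and N_ge: "N \<ge> max 1 (nat \<lceil>8 / \<eta>\<rceil>)" and sq_le: "(\<Sum>j=1..N. (\<omega> j)\<^sup>2) \<le> 2 * real N"
      have N: "N \<ge> 1" "8 / \<eta> \<le> real N" using N_ge by (simp, linarith)
      then have N2: "8 \<le> \<eta> * real N" using \<eta> by (simp add: field_simps)
      define bad where "bad = {i\<in>{1..N}. \<bar>\<omega> i\<bar> > M}"
      have "real (card bad) * M\<^sup>2 = (\<Sum>i\<in>bad. M\<^sup>2)" by simp
      also have "\<dots> \<le> (\<Sum>i\<in>bad. (\<omega> i)\<^sup>2)"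
      proof (rule sum_mono)
        fix i assume "i \<in> bad"
        then have "M\<^sup>2 \<le> \<bar>\<omega> i\<bar>\<^sup>2" using M(1) by (intro power_mono) (auto simp: bad_def)
        then show "M\<^sup>2 \<le> (\<omega> i)\<^sup>2" by simp
      qed
      also have "\<dots> \<le> (\<Sum>j=1..N. (\<omega> j)\<^sup>2)" by (rule sum_mono2) (auto simp: bad_def)
      finally have "real (card bad) * M\<^sup>2 \<le> 2 * real N" using sq_le by simp
      then have bad: "real (card bad) \<le> \<eta> * real N / 8"
        using \<eta> by (simp add: M(2) field_simps)
      have slope': "\<eta> * real N * (h' - h\<^sub>0) \<le> ln (pin_Z K \<beta> h' \<omega> N) - ln (pin_Z K \<beta> h\<^sub>0 \<omega> N)"
        using slope N(1) by (simp add: field_simps)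
      have "\<eta> * real N / 2 / \<kappa> * t\<^sup>2 \<le> (\<eta> * real N - 2 - 2 * real (card bad)) / \<kappa> * t\<^sup>2"
        using bad N2 \<kappa> by (intro mult_right_mono divide_right_mono) auto
      also have "\<dots> \<le> ln (pin_Z K \<beta> (h + t) \<omega> N) + ln (pin_Z K \<beta> (h - t) \<omega> N)
          - 2 * ln (pin_Z K \<beta> h \<omega> N)"
        unfolding \<kappa>_def bad_def
        by (rule ln_pin_Z_symmetric_difference_ge[where h' = h' and h\<^sub>0 = h\<^sub>0 and h\<^sub>1 = "h + 1"])
          (use t slope' Kpos N B beta h0 M(1) in \<open>auto simp: L_def\<close>)
      finally have "\<eta> * real N / 2 / \<kappa> * t\<^sup>2 / real N \<le> (ln (pin_Z K \<beta> (h + t) \<omega> N)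
          + ln (pin_Z K \<beta> (h - t) \<omega> N) - 2 * ln (pin_Z K \<beta> h \<omega> N)) / real N"
        by (rule divide_right_mono) simp
      then show "2 * ?X \<omega> h N - ?X \<omega> (h + t) N - ?X \<omega> (h - t) N \<le> - (\<eta> / 2 / \<kappa> * t\<^sup>2)"
        using N(1) by (simp add: add_divide_distrib diff_divide_distrib)
    qed
    moreover have "(\<lambda>N. 2 * ?X \<omega> h N - ?X \<omega> (h + t) N - ?X \<omega> (h - t) N)
        \<longlonglongrightarrow> 2 * ?F h - ?F (h + t) - ?F (h - t)"
      by (intro tendsto_diff tendsto_mult tendsto_const \<omega>) auto
    ultimately have "2 * ?F h - ?F (h + t) - ?F (h - t) \<le> - (\<eta> / 2 / \<kappa> * t\<^sup>2)"
      by (intro tendsto_frequently_le)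
    then show ?thesis by simp
  qed
  then have "\<eta> / 2 / \<kappa> \<le> deriv (deriv ?F) h"
    using fe_smooth hgt h'(2)
    by (intro second_deriv_ge_of_symmetric_difference[where a = "crit_h K \<mu> \<beta>" and d = "min 1 (h - h')"]) auto
  moreover have "\<eta> / 2 / \<kappa> > 0" using \<eta> \<kappa> by simp
  ultimately show ?thesis by linarith
qed

end
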